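(* Let $G$ be a cyclic group of finite order $n$, and let $1=n_0<n_1<\dots<n_{p-1}<n_p=n$ be all the positive divisors of $n$. For $i=0,\dots,p$ let $H^{(n_i)}$ be the (unique) subgroup of $G$ of index $n_i$. Let $A\subset G$ and let $\overrightarrow{k}=(k_1,\dots,k_m)$ be a vector with $k_1,\dots,k_m\in\{1,\dots,|A|\}$, $k_1\le k_2\le\dots\le k_m$ and $\sum_{i=1}^m k_i=|A|$. Then $$\mathcal{H}(A,\overrightarrow{k})\subseteq \widehat{\mathcal{H}}(A,\overrightarrow{k}):=\left\{H^{(n_i)} : m\le n_i\le \frac{n}{\|\overrightarrow{k}\|}\right\},$$ where $\|\overrightarrow{k}\|=\max\{k_i: 1\le i\le m\}$.
   Context: Let $G$ be a finite or countable group. For a subgroup $H\subset G$ of index $r\in\mathbb{N}\cup\{+\infty\}$, let $H_1=H,H_2,\dots,H_r$ denote its pairwise distinct right cosets $Hx=\{yx:y\in H\}$. Let $A\subset G$ be a finite subset and $\overrightarrow{k}=(k_1,\dots,k_m)$, $m\ge 1$, a vector with $k_1,\dots,k_m\in\{1,\dots,|A|\}$, $k_1\le\dots\le k_m$ and $\sum_{i=1}^m k_i=|A|$. A subgroup $H$ of index $r\ge m$ is called an $(A,\overrightarrow{k})$-ground subgroup if there are pairwise distinct indices $i_1,\dots,i_m$ of right cosets of $H$ such that $|A\cap H_{i_j}|=k_j$ for $j=1,\dots,m$. The set of all $(A,\overrightarrow{k})$-ground subgroups of $G$ is denoted $\mathcal{H}(A,\overrightarrow{k})$. *)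

theory Defs
  imports "HOL-Algebra.Algebra" "HOL-Library.Extended_Nat"
begin

definition index :: "('a, 'b) monoid_scheme \<Rightarrow> 'a set \<Rightarrow> enat" where
  "index G H = (if finite (rcosets\<^bsub>G\<^esub> H) then enat (card (rcosets\<^bsub>G\<^esub> H)) else \<infinity>)"

(* A vector (k_1, ..., k_m) is the list ks; k_j is ks ! (j - 1). *)
definition admissible_vector :: "'a set \<Rightarrow> nat list \<Rightarrow> bool" where
  "admissible_vector A ks \<longleftrightarrow>
     length ks \<ge> 1 \<and> set ks \<subseteq> {1..card A} \<and> sorted ks \<and> sum_list ks = card A"

definition ground_subgroup ::
    "('a, 'b) monoid_scheme \<Rightarrow> 'a set \<Rightarrow> nat list \<Rightarrow> 'a set \<Rightarrow> bool" where
  "ground_subgroup G A ks H \<longleftrightarrow>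
     subgroup H G \<and> enat (length ks) \<le> index G H \<and>
     (\<exists>C. inj_on C {..<length ks} \<and>
          (\<forall>j<length ks. C j \<in> rcosets\<^bsub>G\<^esub> H \<and> card (A \<inter> C j) = ks ! j))"

definition ground_subgroups ::
    "('a, 'b) monoid_scheme \<Rightarrow> 'a set \<Rightarrow> nat list \<Rightarrow> 'a set set" where
  "ground_subgroups G A ks = {H. ground_subgroup G A ks H}"

(* Specified only where G has exactly one subgroup of index d, as for a finite
   cyclic group G and a divisor d of its order. *)
definition subgroup_of_index :: "('a, 'b) monoid_scheme \<Rightarrow> nat \<Rightarrow> 'a set" where
  "subgroup_of_index G d = (THE H. subgroup H G \<and> index G H = enat d)"

definition max_norm :: "nat list \<Rightarrow> nat" where
  "max_norm ks = Max (set ks)"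

end

theory Submission
  imports Defs
begin

text \<open>
  Let \<open>H\<close> be a ground subgroup. By Lagrange's theorem its index is a divisor \<open>d\<close> of \<open>n\<close>, so \<open>d\<close> is
  one of the \<open>ns i\<close>, and \<open>d\<close> is at least the number of entries of \<open>ks\<close> by the definition of a ground
  subgroup. Every right coset of \<open>H\<close> has exactly \<open>n / d\<close> elements. Each entry of \<open>ks\<close>, hence also the
  largest one, is the size of the part of \<open>A\<close> that lies in such a coset, so it is at most \<open>n / d\<close>;
  this is the upper bound on \<open>d\<close>.

  What remains is that \<open>H\<close> is the subgroup of index \<open>d\<close>, that is, that a finite cyclic group has at
  most one subgroup of a given index (\<open>subgroup_of_cyclic_eq_powers\<close>): with a generator \<open>g\<close>,
  Lagrange's theorem applied within \<open>H\<close> forces every element of \<open>H\<close> to be a power of \<open>g ^ d\<close>, and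
  counting shows that \<open>H\<close> contains all of these.
\<close>

lemma (in group) pow_card_subgroup_eq_one:
  assumes "subgroup H G" and "h \<in> H"
  shows "h [^] card H = \<one>"
proof -
  have "h [^]\<^bsub>G\<lparr>carrier := H\<rparr>\<^esub> card H = \<one>\<^bsub>G\<lparr>carrier := H\<rparr>\<^esub>"
    using group.pow_order_eq_1[OF subgroup_imp_group[OF assms(1)], of h] assms(2)
    by (simp add: order_def)
  then show ?thesis
    by (simp flip: nat_pow_consistent)
qed

lemma (in group) finite_cyclic_generator:
  assumes "cyclic_group G" and "finite (carrier G)"
  obtains g where "g \<in> carrier G" "ord g = order G" "carrier G = range (\<lambda>k::nat. g [^] k)"
proof -
  obtain g where g: "g \<in> carrier G" and G: "carrier G = range (\<lambda>k::int. g [^] k)"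
    using assms(1) cyclic_group by auto
  have gen: "generate G {g} = carrier G"
    using generate_pow[OF g] G by auto
  have "ord g = order G"
    using generate_pow_card[OF g] gen by (simp add: order_def)
  moreover have "carrier G = range (\<lambda>k::nat. g [^] k)"
    using generate_pow_on_finite_carrier[OF assms(2) g] gen by auto
  ultimately show ?thesis
    using that g by blast
qed

text \<open>
  If \<open>h = g ^ k\<close> lies in \<open>H\<close>, then \<open>h\<close> raised to the order \<open>c\<close> of \<open>H\<close> is trivial, so the order
  \<open>d * c\<close> of \<open>g\<close> divides \<open>k * c\<close>, and hence \<open>d\<close> divides \<open>k\<close>. There are at most \<open>c\<close> powers of
  \<open>g ^ d\<close>, and \<open>H\<close> has \<open>c\<close> elements, so the inclusion is an equality. The right-hand side depends
  on \<open>H\<close> only through its index, which is what gives uniqueness.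
\<close>

lemma (in group) subgroup_of_cyclic_eq_powers:
  assumes g: "g \<in> carrier G" "ord g = order G" "carrier G = range (\<lambda>k::nat. g [^] k)"
    and fin: "finite (carrier G)"
    and H: "subgroup H G" and d: "card (rcosets H) = d"
  shows "H = (\<lambda>j::nat. g [^] (d * j)) ` {..<order G div d}"
proof -
  define c where "c = card H"
  have dc: "d * c = order G"
    using lagrange[OF H] d by (simp add: c_def)
  have "order G > 0"
    using fin by (simp add: order_gt_0_iff_finite)
  with dc have pos: "c > 0" "d > 0"
    by (auto intro: gr0I)
  have c_eq: "order G div d = c"
    using dc pos by (metis nonzero_mult_div_cancel_left less_irrefl)
  have sub: "H \<subseteq> (\<lambda>j::nat. g [^] (d * j)) ` {..<c}"
  proof
    fix h assume h: "h \<in> H"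
    then obtain k :: nat where k: "h = g [^] k"
      using g(3) subgroup.subset[OF H] by blast
    have "g [^] (k * c) = \<one>"
      using pow_card_subgroup_eq_one[OF H h] k g(1) by (simp add: nat_pow_pow c_def)
    then have "d * c dvd k * c"
      using pow_eq_id[OF g(1)] g(2) dc by metis
    then obtain j where j: "k = d * j"
      using pos by (auto elim: dvdE)
    \<comment> \<open>Reducing the exponent modulo the order of \<open>g\<close> brings \<open>j\<close> below \<open>c\<close>.\<close>
    have "d * j = d * c * (j div c) + d * (j mod c)"
      by (metis mult.assoc distrib_left mult_div_mod_eq)
    then have "h = g [^] (d * c * (j div c)) \<otimes> g [^] (d * (j mod c))"
      using k j g(1) by (simp add: nat_pow_mult)
    also have "g [^] (d * c * (j div c)) = \<one>"
      using pow_eq_id[OF g(1)] g(2) dc by simp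
    finally have "h = g [^] (d * (j mod c))"
      using g(1) by simp
    then show "h \<in> (\<lambda>j::nat. g [^] (d * j)) ` {..<c}"
      using pos by auto
  qed
  moreover have "card ((\<lambda>j::nat. g [^] (d * j)) ` {..<c}) \<le> card H"
    using card_image_le[of "{..<c}"] by (simp add: c_def)
  ultimately show ?thesis
    unfolding c_eq by (intro card_seteq) auto
qed

lemma (in group) index_eq_card_rcosets:
  assumes "finite (carrier G)" and "subgroup H G"
  shows "index G H = enat (card (rcosets H))"
  using finite_subset[OF rcosets_subset_PowG[OF assms(2)]] assms(1)
  by (simp add: index_def)

lemma (in group) subgroup_of_index_card_rcosets:
  assumes "cyclic_group G" and fin: "finite (carrier G)" and H: "subgroup H G"
  shows "subgroup_of_index G (card (rcosets H)) = H"
  unfolding subgroup_of_index_def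
proof (rule the_equality)
  show "subgroup H G \<and> index G H = enat (card (rcosets H))"
    using index_eq_card_rcosets[OF fin H] H by simp
next
  fix K assume K: "subgroup K G \<and> index G K = enat (card (rcosets H))"
  then have "card (rcosets K) = card (rcosets H)"
    using index_eq_card_rcosets[OF fin, of K] by simp
  then show "K = H"
    using finite_cyclic_generator[OF assms(1,2)] subgroup_of_cyclic_eq_powers fin H K
    by metis
qed

lemma (in group) max_norm_le_card_ground_subgroup:
  assumes fin: "finite (carrier G)" and ne: "ks \<noteq> []" and H: "ground_subgroup G A ks H"
  shows "max_norm ks \<le> card H"
proof -
  have sub: "subgroup H G"
    using H by (simp add: ground_subgroup_def)
  have "max_norm ks \<in> set ks"
    using ne by (simp add: max_norm_def)
  then obtain j where j: "j < length ks" "max_norm ks = ks ! j"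
    by (metis in_set_conv_nth)
  then obtain C where C: "C \<in> rcosets H" "card (A \<inter> C) = max_norm ks"
    using H unfolding ground_subgroup_def by metis
  have "finite C"
    using C(1) rcosets_subset_PowG[OF sub] fin by (auto intro: finite_subset)
  then have "max_norm ks \<le> card C"
    using C(2) by (metis card_mono inf_le2)
  also have "card C = card H"
    using card_rcosets_equal[OF C(1) subgroup.subset[OF sub]] by simp
  finally show ?thesis .
qed

theorem theorem4p1:
  fixes G :: "('a, 'b) monoid_scheme"
    and n p :: nat
    and ns :: "nat \<Rightarrow> nat"
    and A :: "'a set"
    and ks :: "nat list"
  assumes "group G" and "cyclic_group G" and "finite (carrier G)" and "order G = n"
    and "ns 0 = 1" and "ns p = n" and "strict_mono_on {0..p} ns"
    and "ns ` {0..p} = {d. d > 0 \<and> d dvd n}"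
    and "A \<subseteq> carrier G"
    and "admissible_vector A ks"
  shows "ground_subgroups G A ks \<subseteq>
    {subgroup_of_index G (ns i) | i.
       i \<le> p \<and> length ks \<le> ns i \<and> real (ns i) \<le> real n / real (max_norm ks)}"
proof
  interpret group G by fact
  fix H assume "H \<in> ground_subgroups G A ks"
  then have ground: "ground_subgroup G A ks H"
    by (simp add: ground_subgroups_def)
  then have H: "subgroup H G"
    by (simp add: ground_subgroup_def)
  define d where "d = card (rcosets\<^bsub>G\<^esub> H)"
  have dn: "d * card H = n"
    using lagrange[OF H] assms(4) by (simp add: d_def)
  have "n > 0"
    using assms(3,4) order_gt_0_iff_finite by auto
  with dn have "d \<in> ns ` {0..p}"
    unfolding assms(8) by (auto intro: gr0I)
  then obtain i where i: "i \<le> p" "ns i = d"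
    by auto
  have len: "length ks \<le> d"
    using ground index_eq_card_rcosets[OF assms(3) H]
    by (simp add: ground_subgroup_def d_def)
  have ne: "ks \<noteq> []" and ks: "set ks \<subseteq> {1..card A}"
    using assms(10) by (auto simp: admissible_vector_def)
  \<comment> \<open>Positivity of the entries makes the quotient by their maximum meaningful.\<close>
  have "max_norm ks \<in> set ks"
    using ne by (simp add: max_norm_def)
  with ks have pos: "max_norm ks > 0"
    by auto
  have "d * max_norm ks \<le> n"
    using max_norm_le_card_ground_subgroup[OF assms(3) ne ground] dn
    by (metis mult_le_mono2)
  then have "real d * real (max_norm ks) \<le> real n"
    by (metis of_nat_le_iff of_nat_mult)
  then have "real d \<le> real n / real (max_norm ks)"
    using pos by (simp add: pos_le_divide_eq)
  moreover have "H = subgroup_of_index G (ns i)"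
    using subgroup_of_index_card_rcosets[OF assms(2,3) H] i by (simp add: d_def)
  ultimately show "H \<in> {subgroup_of_index G (ns i) | i.
       i \<le> p \<and> length ks \<le> ns i \<and> real (ns i) \<le> real n / real (max_norm ks)}"
    using i len by blast
qed

end
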